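(* Let $\mathbf{u}$ be a Parry word, fixed point of $\varphi$, that is $c$-balanced for some $c>0$. Let $L$, the sets $\mathcal{S}(n)$, the sets $\mathcal{S}_0,\mathcal{S}_1,\dots,\mathcal{S}_M$, the transition function $\delta$ and the output function $\tau$ be as specified in the context. Then for all $n\in\mathbb{N}$ the abelian complexity of $\mathbf{u}$ is given by $$\rho^{\mathrm{ab}}(n)=\tau\left(\delta(0,\langle n\rangle_U)\right).$$
   Context: $\mathbb{N}=\{1,2,3,\dots\}$. For a finite word $w$, $|w|$ is its length and $|w|_\ell$ the number of occurrences of the letter $\ell$. Parry words. A simple Parry word over $\mathcal{A}=\{0,1,\dots,m-1\}$ ($m\ge 2$) is the fixed point $\mathbf{u}=u_0u_1u_2\cdots$ of the substitution $\varphi(\ell)=0^{\alpha_\ell}(\ell+1)$ for $0\le \ell\le m-2$, $\varphi(m-1)=0^{\alpha_{m-1}}$. A non-simple Parry word over $\mathcal{A}=\{0,1,\dots,m+p-1\}$ ($m,p\ge1$) is the fixed point $\mathbf{u}=u_0u_1u_2\cdots$ of $\varphi(\ell)=0^{\alpha_\ell}(\ell+1)$ for $0\le\ell\le m+p-2$, $\varphi(m+p-1)=0^{\alpha_{m+p-1}}m$. The $\alpha_\ell$ are non-negative integers with $\alpha_0\ge1$ and $\alpha_\ell\le\alpha_0$ for all $\ell\in\mathcal{A}$; in the simple case $\alpha_{m-1}\ge1$; in the non-simple case $\alpha_\ell\ge1$ for some $\ell\in\{m,\dots,m+p-1\}$. Moreover they satisfy Parry's condition: putting $t=\alpha_0\cdots\alpha_{m-1}0^\omega$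 (simple case) or $t=\alpha_0\cdots\alpha_{m-1}(\alpha_m\cdots\alpha_{m+p-1})^\omega$ (non-simple case), every shift $t_it_{i+1}\cdots$ with $i\ge1$ is strictly lexicographically smaller than $t=t_0t_1\cdots$. Normal $U$-representation. $U_j=|\varphi^j(0)|$. For $n\in\mathbb{N}$, $\langle n\rangle_U=d_kd_{k-1}\cdots d_0$ is the word of digits of the expansion $n=\sum_{j=0}^k d_jU_j$ obtained by the greedy algorithm ($U_k\le n<U_{k+1}$, so $d_k\neq0$); all digits lie in $\{0,1,\dots,\alpha_0\}$. $c$-balanced: $\bigl||v|_\ell-|w|_\ell\bigr|\le c$ for every $\ell\in\mathcal{A}$ and all factors $v,w$ of $\mathbf{u}$ with $|v|=|w|$. $\Psi(w)=(|w|_\ell)_{\ell\in\mathcal{A}}$ is the Parikh vector of $w$; $\rho^{\mathrm{ab}}(n)=\#\{\Psi(w): w\text{ a factor of }\mathbf{u},|w|=n\}$ is the abelian complexity; for a factor $w$ of length $n$, the relative Parikh vector is $\Psi^{\mathrm{rel}}(w)=\Psi(w)-\Psi(u_0u_1\cdots u_{n-1})$. $\mathcal{M}$ is the incidence matrix of $\varphi$, with entry $|\varphi(i)|_j$ in row $i$, column $j$ ($i,j\in\mathcal{A}$). Constants $H,L$. $H$ is a fixed number with $H\ge|h_w|$ for every factor $w$ of $\mathbf{u}$, where $h_w$ is the sum of components of the row vector $\Psi^{\mathrm{rel}}(w)\mathcal{M}$. $L\in\mathbb{N}$ is a fixed number such that every factor $w$ of $\mathbf{u}$ with $|w|\ge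 L$ satisfies $|\varphi(w)|-|w|\ge2\alpha_0+H$. (Such $H,L$ exist.) For $n\in\mathbb{N}$ put $$\mathcal{S}(n)=\{(\Psi^{\mathrm{rel}}(u_ju_{j+1}\cdots u_{j+n-1}),\,u_j,\,u_{j+n-L}\cdots u_{j+n+L}) : j\ge L\}.$$ $\mathcal{S}_1,\dots,\mathcal{S}_M$ is a fixed finite list of finite sets of triples such that every $\mathcal{S}(n)$, $n\in\mathbb{N}$, equals some $\mathcal{S}_j$, enumerated so that $\mathcal{S}_d=\mathcal{S}(d)$ for $d=1,\dots,\alpha_0$; formally $\mathcal{S}_0=\mathcal{S}(0)=\emptyset$. $\delta$: a function with values $\delta(j,d)\in\{1,\dots,M\}$ for $j\in\{1,\dots,M\}$, $d\in\{0,\dots,\alpha_0\}$, such that whenever $n,N\in\mathbb{N}$ satisfy $\langle N\rangle_U=\langle n\rangle_U\,d$ (the digit $d$ appended at the end), then $\mathcal{S}(n)=\mathcal{S}_j$ implies $\mathcal{S}(N)=\mathcal{S}_{\delta(j,d)}$; moreover $\delta(0,d)=d$ for $d=1,\dots,\alpha_0$. (Such lists and functions exist.) It is extended to words by $\delta(0,d_kd_{k-1}\cdots d_0)=\delta(\delta(\cdots\delta(\delta(0,d_k),d_{k-1})\cdots,d_1),d_0)$. $\tau(j)=\#\mathcal{P}^{\mathrm{rel}}_j$ for $j=1,\dots,M$, where $\mathcal{P}^{\mathrm{rel}}_j=\{\psi : (\psi,a,b_{-L}\cdots b_L)\in\mathcal{S}_j\}$ is the set of first components. *)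

theory Defs
  imports Complex_Main
begin

text \<open>
  Letters are natural numbers and the alphabet of size \<open>K\<close> is \<open>{0, \<dots>, K - 1}\<close>. Finite words are
  lists, infinite words are functions from \<open>nat\<close>, substitutions are given by their images of
  letters. Vectors indexed by the alphabet are functions on \<open>nat\<close>; for words over the alphabet they
  vanish outside \<open>{0, \<dots>, K - 1}\<close>, so equality of such functions is equality of vectors.
\<close>

definition subst_word :: "(nat \<Rightarrow> nat list) \<Rightarrow> nat list \<Rightarrow> nat list" where
  "subst_word \<phi> w = concat (map \<phi> w)"

definition factor_at :: "(nat \<Rightarrow> nat) \<Rightarrow> nat \<Rightarrow> nat \<Rightarrow> nat list" where
  "factor_at u j n = map u [j..<j + n]"

definition factors :: "(nat \<Rightarrow> nat) \<Rightarrow> nat list set" where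
  "factors u = {factor_at u j n | j n. True}"

text \<open>
  The images of the prefixes of \<open>u\<close> are prefixes of \<open>u\<close>. For a substitution that erases no letter
  of \<open>u\<close>, such as those below, these images are arbitrarily long, so this says that the image of
  \<open>u\<close> is \<open>u\<close>.
\<close>

definition fixed_point :: "(nat \<Rightarrow> nat list) \<Rightarrow> (nat \<Rightarrow> nat) \<Rightarrow> bool" where
  "fixed_point \<phi> u \<longleftrightarrow>
     (\<forall>n. subst_word \<phi> (factor_at u 0 n) = factor_at u 0 (length (subst_word \<phi> (factor_at u 0 n))))"


subsection \<open>Parry words\<close>

definition lex_less :: "(nat \<Rightarrow> nat) \<Rightarrow> (nat \<Rightarrow> nat) \<Rightarrow> bool" where
  "lex_less s t \<longleftrightarrow> (\<exists>k. (\<forall>i<k. s i = t i) \<and> s k < t k)"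

definition parry_condition :: "(nat \<Rightarrow> nat) \<Rightarrow> bool" where
  "parry_condition t \<longleftrightarrow> (\<forall>i\<ge>1. lex_less (\<lambda>k. t (i + k)) t)"

definition simple_parry_word ::
    "nat \<Rightarrow> (nat \<Rightarrow> nat) \<Rightarrow> (nat \<Rightarrow> nat list) \<Rightarrow> (nat \<Rightarrow> nat) \<Rightarrow> bool" where
  "simple_parry_word m \<alpha> \<phi> u \<longleftrightarrow>
     m \<ge> 2 \<and>
     \<alpha> 0 \<ge> 1 \<and> (\<forall>l<m. \<alpha> l \<le> \<alpha> 0) \<and> \<alpha> (m - 1) \<ge> 1 \<and>
     parry_condition (\<lambda>i. if i < m then \<alpha> i else 0) \<and>
     (\<forall>l<m - 1. \<phi> l = replicate (\<alpha> l) 0 @ [l + 1]) \<and>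
     \<phi> (m - 1) = replicate (\<alpha> (m - 1)) 0 \<and>
     (\<forall>i. u i < m) \<and> fixed_point \<phi> u"

definition nonsimple_parry_word ::
    "nat \<Rightarrow> nat \<Rightarrow> (nat \<Rightarrow> nat) \<Rightarrow> (nat \<Rightarrow> nat list) \<Rightarrow> (nat \<Rightarrow> nat) \<Rightarrow> bool" where
  "nonsimple_parry_word m p \<alpha> \<phi> u \<longleftrightarrow>
     m \<ge> 1 \<and> p \<ge> 1 \<and>
     \<alpha> 0 \<ge> 1 \<and> (\<forall>l<m + p. \<alpha> l \<le> \<alpha> 0) \<and> (\<exists>l\<in>{m..<m + p}. \<alpha> l \<ge> 1) \<and>
     parry_condition (\<lambda>i. if i < m then \<alpha> i else \<alpha> (m + (i - m) mod p)) \<and>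
     (\<forall>l<m + p - 1. \<phi> l = replicate (\<alpha> l) 0 @ [l + 1]) \<and>
     \<phi> (m + p - 1) = replicate (\<alpha> (m + p - 1)) 0 @ [m] \<and>
     (\<forall>i. u i < m + p) \<and> fixed_point \<phi> u"

definition parry_word ::
    "nat \<Rightarrow> (nat \<Rightarrow> nat) \<Rightarrow> (nat \<Rightarrow> nat list) \<Rightarrow> (nat \<Rightarrow> nat) \<Rightarrow> bool" where
  "parry_word K \<alpha> \<phi> u \<longleftrightarrow>
     simple_parry_word K \<alpha> \<phi> u \<or> (\<exists>m p. K = m + p \<and> nonsimple_parry_word m p \<alpha> \<phi> u)"


subsection \<open>Normal \<open>U\<close>-representations\<close>

definition U_seq :: "(nat \<Rightarrow> nat list) \<Rightarrow> nat \<Rightarrow> nat" where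
  "U_seq \<phi> j = length ((subst_word \<phi> ^^ j) [0])"

text \<open>Greedy digits at the positions \<open>k - 1, \<dots>, 0\<close>, most significant digit first.\<close>

primrec greedy_digits :: "(nat \<Rightarrow> nat) \<Rightarrow> nat \<Rightarrow> nat \<Rightarrow> nat list" where
  "greedy_digits U 0 n = []"
| "greedy_digits U (Suc k) n = (n div U k) # greedy_digits U k (n mod U k)"

text \<open>
  Only meaningful for \<open>n \<ge> 1\<close>: for a Parry word \<open>U\<close> is strictly increasing from \<open>1\<close>, so the
  leading position exists and is unique.
\<close>

definition normal_rep :: "(nat \<Rightarrow> nat) \<Rightarrow> nat \<Rightarrow> nat list" where
  "normal_rep U n = greedy_digits U (Suc (THE k. U k \<le> n \<and> n < U (Suc k))) n"


subsection \<open>Balance, Parikh vectors and abelian complexity\<close>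

definition balanced :: "nat \<Rightarrow> (nat \<Rightarrow> nat) \<Rightarrow> real \<Rightarrow> bool" where
  "balanced K u c \<longleftrightarrow>
     (\<forall>v\<in>factors u. \<forall>w\<in>factors u. length v = length w \<longrightarrow>
        (\<forall>l<K. \<bar>real (count_list v l) - real (count_list w l)\<bar> \<le> c))"

definition parikh :: "nat list \<Rightarrow> nat \<Rightarrow> int" where
  "parikh w = (\<lambda>l. int (count_list w l))"

definition abelian_complexity :: "(nat \<Rightarrow> nat) \<Rightarrow> nat \<Rightarrow> nat" where
  "abelian_complexity u n = card {parikh w | w. w \<in> factors u \<and> length w = n}"

definition parikh_rel :: "(nat \<Rightarrow> nat) \<Rightarrow> nat list \<Rightarrow> nat \<Rightarrow> int" where
  "parikh_rel u w = (\<lambda>l. parikh w l - parikh (factor_at u 0 (length w)) l)"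

definition incidence_matrix :: "(nat \<Rightarrow> nat list) \<Rightarrow> nat \<Rightarrow> nat \<Rightarrow> int" where
  "incidence_matrix \<phi> i j = int (count_list (\<phi> i) j)"

definition row_mult :: "nat \<Rightarrow> (nat \<Rightarrow> int) \<Rightarrow> (nat \<Rightarrow> nat \<Rightarrow> int) \<Rightarrow> nat \<Rightarrow> int" where
  "row_mult K x A = (\<lambda>j. \<Sum>i<K. x i * A i j)"

definition h_sum :: "nat \<Rightarrow> (nat \<Rightarrow> nat list) \<Rightarrow> (nat \<Rightarrow> nat) \<Rightarrow> nat list \<Rightarrow> int" where
  "h_sum K \<phi> u w = (\<Sum>j<K. row_mult K (parikh_rel u w) (incidence_matrix \<phi>) j)"


subsection \<open>States, transitions and output\<close>

type_synonym triple = "(nat \<Rightarrow> int) \<times> nat \<times> nat list"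

text \<open>The index \<open>j + n - L\<close> is never truncated, because \<open>j \<ge> L\<close>.\<close>

definition S_set :: "(nat \<Rightarrow> nat) \<Rightarrow> nat \<Rightarrow> nat \<Rightarrow> triple set" where
  "S_set u L n =
     (if n = 0 then {}
      else {(parikh_rel u (factor_at u j n), u j, factor_at u (j + n - L) (2 * L + 1)) | j. j \<ge> L})"

definition delta_word :: "(nat \<Rightarrow> nat \<Rightarrow> nat) \<Rightarrow> nat \<Rightarrow> nat list \<Rightarrow> nat" where
  "delta_word \<delta> j ds = foldl \<delta> j ds"

definition P_rel :: "triple set \<Rightarrow> (nat \<Rightarrow> int) set" where
  "P_rel T = {\<psi>. \<exists>a b. (\<psi>, a, b) \<in> T}"

definition tau :: "(nat \<Rightarrow> triple set) \<Rightarrow> nat \<Rightarrow> nat" where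
  "tau S j = card (P_rel (S j))"

end

theory Submission imports Defs begin

text \<open>
  The automaton reads \<open>\<langle>n\<rangle>\<^sub>U\<close> from the most significant digit, and its state after a prefix of
  this word is meant to be an index of \<open>\<S>(k)\<close>, where \<open>k\<close> is the number which the prefix represents.
  The step property of \<open>\<delta>\<close> speaks only of pairs \<open>k, N\<close> whose normal representations differ by one
  appended digit, so everything rests on the fact that a nonempty prefix of a normal representation
  is again a normal representation (\<open>normal_rep_cases\<close>). Given this, induction on the number of
  digits yields \<open>\<S>(n) = \<S>\<^sub>j\<close> for the final state \<open>j\<close>.

  A digit string is produced by the greedy algorithm iff the value of each of its suffixes is
  smaller than the corresponding \<open>U\<^sub>i\<close>. That this survives the deletion of the last digit
  (\<open>greedy_butlast\<close>) is where Parry's condition enters. Write \<open>T\<^sub>l(j)\<close> for the length of the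
  \<open>j\<close>-th image of the letter \<open>l\<close>; then \<open>U\<^sub>j = T\<^sub>0(j)\<close> and \<open>T\<^sub>l(j + 1) = t\<^sub>l U\<^sub>j + T\<^sub>l\<^sub>+\<^sub>1(j)\<close>.
  Since the shifts of \<open>t\<close> are lexicographically smaller than \<open>t\<close>, one has \<open>T\<^sub>l(j) \<le> U\<^sub>j\<close>
  (\<open>img_len_le_U\<close>), so comparing values with \<open>T\<^sub>l(j)\<close> amounts to comparing digits with
  \<open>t\<^sub>l t\<^sub>l\<^sub>+\<^sub>1 \<dots>\<close>, and a lexicographic comparison is not affected by shortening.

  Finally, \<open>\<tau>\<close> counts the relative Parikh vectors of the factors of length \<open>n\<close> that start at a
  position \<open>\<ge> L\<close>. Relative Parikh vectors arise from Parikh vectors by a translation, and \<open>u\<close> is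
  recurrent (\<open>parry_word_recurrent\<close>), so starting late loses no factor.
\<close>


section \<open>Lengths of iterated images and Parry's condition\<close>

text \<open>
  \<open>img_len t j l\<close>, written \<open>T\<^sub>l(j)\<close> in the comments, is the length of \<open>\<phi>\<^sup>j(l)\<close>, with \<open>l\<close> ranging
  over the shifts of \<open>t\<close> rather than over the finite alphabet. In the non-simple case shifts \<open>l \<ge> m\<close>
  that differ by the period stand for the same letter. In the simple case the shifts
  \<open>l \<ge> m\<close>, whose tail is zero, stand for the empty word; the base case makes this distinction in terms of \<open>t\<close> alone, so that both kinds of Parry words are
  covered at once.
\<close>

primrec img_len :: "(nat \<Rightarrow> nat) \<Rightarrow> nat \<Rightarrow> nat \<Rightarrow> nat" where
  "img_len t 0 l = (if \<exists>i\<ge>l. t i \<noteq> 0 then 1 else 0)"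
| "img_len t (Suc j) l = t l * img_len t j 0 + img_len t j (Suc l)"

text \<open>
  The claim is proved for all pairs of shifts at once: at the first digit where the two shifts
  differ, the smaller one loses a full \<open>U\<^sub>j\<close>, and the case \<open>l' = 0\<close> of the induction hypothesis says
  that what follows is worth at most \<open>U\<^sub>j\<close>.
\<close>

lemma img_len_mono_lex:
  assumes "parry_condition t"
    and "(\<forall>k. t (l + k) = t (l' + k)) \<or> lex_less (\<lambda>k. t (l + k)) (\<lambda>k. t (l' + k))"
  shows "img_len t j l \<le> img_len t j l'"
  using assms(2)
proof (induction j arbitrary: l l')
  case 0
  have "\<exists>i\<ge>l'. t i \<noteq> 0" if nz: "i \<ge> l" "t i \<noteq> 0" for i
  proof -
    obtain k where k: "i = l + k" using nz(1) le_Suc_ex by blast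
    from 0 show ?thesis
    proof
      assume "\<forall>k. t (l + k) = t (l' + k)"
      then show ?thesis using nz k by (intro exI[of _ "l' + k"]) auto
    next
      assume "lex_less (\<lambda>k. t (l + k)) (\<lambda>k. t (l' + k))"
      then obtain r where "t (l + r) < t (l' + r)" unfolding lex_less_def by blast
      then show ?thesis by (intro exI[of _ "l' + r"]) auto
    qed
  qed
  then show ?case by auto
next
  case (Suc j)
  show ?case
  proof (cases "t l = t l'")
    case True
    have "(\<forall>k. t (Suc l + k) = t (Suc l' + k)) \<or>
      lex_less (\<lambda>k. t (Suc l + k)) (\<lambda>k. t (Suc l' + k))"
      using Suc.prems
    proof
      assume "\<forall>k. t (l + k) = t (l' + k)"
      then show ?thesis by (metis add_Suc_right add_Suc)
    next
      assume "lex_less (\<lambda>k. t (l + k)) (\<lambda>k. t (l' + k))"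
      then obtain r where r: "\<forall>i<r. t (l + i) = t (l' + i)" "t (l + r) < t (l' + r)"
        unfolding lex_less_def by blast
      then obtain q where q: "r = Suc q" using True by (cases r) auto
      have "lex_less (\<lambda>k. t (Suc l + k)) (\<lambda>k. t (Suc l' + k))"
        unfolding lex_less_def
      proof (intro exI[of _ q] conjI allI impI)
        fix i assume "i < q"
        then show "t (Suc l + i) = t (Suc l' + i)" using r(1)[rule_format, of "Suc i"] q by simp
      next
        show "t (Suc l + q) < t (Suc l' + q)" using r(2) q by simp
      qed
      then show ?thesis ..
    qed
    from Suc.IH[OF this] True show ?thesis by simp
  next
    case False
    have less: "t l < t l'"
      using Suc.prems
    proof
      assume "\<forall>k. t (l + k) = t (l' + k)"
      then show ?thesis using False by (metis add_0_right)
    next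
      assume "lex_less (\<lambda>k. t (l + k)) (\<lambda>k. t (l' + k))"
      then obtain r where r: "\<forall>i<r. t (l + i) = t (l' + i)" "t (l + r) < t (l' + r)"
        unfolding lex_less_def by blast
      have "r = 0" using r(1)[rule_format, of 0] False by (cases r) auto
      then show ?thesis using r(2) by simp
    qed
    have "lex_less (\<lambda>k. t (Suc l + k)) t"
      using assms(1) unfolding parry_condition_def by (metis le_add1 plus_1_eq_Suc)
    then have "img_len t j (Suc l) \<le> img_len t j 0" by (intro Suc.IH) simp
    then have "img_len t (Suc j) l \<le> Suc (t l) * img_len t j 0" by simp
    also have "\<dots> \<le> t l' * img_len t j 0" using less by (intro mult_right_mono) auto
    finally show ?thesis by simp
  qed
qed

lemma img_len_le_U:
  assumes "parry_condition t"
  shows "img_len t j l \<le> img_len t j 0"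
proof (cases "l = 0")
  case False
  then have "lex_less (\<lambda>k. t (l + k)) t" using assms unfolding parry_condition_def by simp
  then show ?thesis by (intro img_len_mono_lex[OF assms]) simp
qed simp

lemma img_len_pos:
  assumes "\<exists>i\<ge>l. t i \<noteq> 0"
  shows "img_len t j l > 0"
  using assms
proof (induction j arbitrary: l)
  case (Suc j)
  show ?case
  proof (cases "t l = 0")
    case True
    have "\<exists>i\<ge>Suc l. t i \<noteq> 0" using Suc.prems True by (metis le_antisym not_less_eq_eq)
    then show ?thesis using Suc.IH[of "Suc l"] by simp
  next
    case False
    then have "img_len t j 0 > 0" by (intro Suc.IH) auto
    then show ?thesis using False by simp
  qed
qed simp

lemma parry_condition_head_pos:
  assumes "parry_condition t" "\<exists>i\<ge>1. t i \<noteq> 0"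
  shows "t 0 \<ge> 1"
proof -
  obtain i where i: "i \<ge> 1" "t i \<noteq> 0" using assms(2) by blast
  then obtain r where r: "\<forall>k<r. t (i + k) = t k" "t (i + r) < t r"
    using assms(1) unfolding parry_condition_def lex_less_def by blast
  show ?thesis
  proof (cases r)
    case 0
    then show ?thesis using r(2) by simp
  next
    case (Suc q)
    then show ?thesis using r(1)[rule_format, of 0] i by simp
  qed
qed

lemma U_less_Suc:
  assumes "parry_condition t" "\<exists>i\<ge>1. t i \<noteq> 0"
  shows "img_len t j 0 < img_len t (Suc j) 0"
proof -
  have "img_len t j (Suc 0) > 0" using assms(2) by (intro img_len_pos) simp
  moreover have "img_len t j 0 \<le> t 0 * img_len t j 0"
    using parry_condition_head_pos[OF assms] by simp
  ultimately show ?thesis unfolding img_len.simps by linarith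
qed


section \<open>Greedy digit strings\<close>

primrec digit_val :: "(nat \<Rightarrow> nat) \<Rightarrow> nat list \<Rightarrow> nat" where
  "digit_val U [] = 0"
| "digit_val U (d # ds) = d * U (length ds) + digit_val U ds"

primrec greedy :: "(nat \<Rightarrow> nat) \<Rightarrow> nat list \<Rightarrow> bool" where
  "greedy U [] \<longleftrightarrow> True"
| "greedy U (d # ds) \<longleftrightarrow> digit_val U (d # ds) < U (Suc (length ds)) \<and> greedy U ds"

lemma length_greedy_digits [simp]: "length (greedy_digits U k n) = k"
  by (induction k arbitrary: n) auto

lemma greedy_imp_val_less:
  assumes "greedy U ds" "U 0 > 0"
  shows "digit_val U ds < U (length ds)"
  using assms by (cases ds) auto

lemma greedy_greedy_digits:
  assumes "\<And>i. U i > 0" "n < U k" "U 0 = 1"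
  shows "greedy U (greedy_digits U k n) \<and> digit_val U (greedy_digits U k n) = n"
  using assms(2)
proof (induction k arbitrary: n)
  case 0
  then show ?case using assms(3) by simp
next
  case (Suc k)
  have "n mod U k < U k" using assms(1) by simp
  from Suc.IH[OF this] Suc.prems show ?case by simp
qed

lemma greedy_digits_unique:
  assumes "greedy U ds" "U 0 > 0"
  shows "greedy_digits U (length ds) (digit_val U ds) = ds"
  using assms(1)
proof (induction ds)
  case (Cons d ds)
  then have "digit_val U ds < U (length ds)" using greedy_imp_val_less assms(2) by simp
  then show ?case using Cons by simp
qed simp

text \<open>
  The bound by \<open>T\<^sub>l\<close> with arbitrary \<open>l\<close> is what makes the induction on the string work: while the
  digits agree with \<open>t\<^sub>l t\<^sub>l\<^sub>+\<^sub>1 \<dots>\<close> the bound moves on to the next shift; at a smaller digit the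
  remainder may be anything below the full \<open>U\<^sub>i\<close>, which is the case \<open>l = 0\<close>; a larger digit is
  excluded by \<open>T\<^sub>l\<^sub>+\<^sub>1(j) \<le> U\<^sub>j\<close>.
\<close>

lemma digit_val_butlast_less_img_len:
  assumes parry: "parry_condition t" and nz: "t 0 \<noteq> 0"
    and "greedy (\<lambda>j. img_len t j 0) (ds @ [d])"
    and "digit_val (\<lambda>j. img_len t j 0) (ds @ [d]) < img_len t (Suc (length ds)) l"
  shows "digit_val (\<lambda>j. img_len t j 0) ds < img_len t (length ds) l"
  using assms(3,4)
proof (induction ds arbitrary: l)
  case Nil
  \<comment> \<open>A tail of \<open>t\<close> with \<open>T\<^sub>l(1) > 0\<close> is nonzero, so \<open>T\<^sub>l(0) = 1\<close>.\<close>
  have "\<exists>i\<ge>l. t i \<noteq> 0"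
  proof (cases "t l = 0")
    case True
    then have "\<exists>i\<ge>Suc l. t i \<noteq> 0" using Nil by (auto split: if_splits)
    then show ?thesis using Suc_leD by blast
  qed auto
  then show ?case by simp
next
  case (Cons e es)
  let ?U = "\<lambda>j. img_len t j 0"
  let ?j = "length es"
  have gr: "greedy ?U (es @ [d])" using Cons.prems(1) by simp
  have bound: "e * ?U (Suc ?j) + digit_val ?U (es @ [d])
      < t l * ?U (Suc ?j) + img_len t (Suc ?j) (Suc l)"
    using Cons.prems(2) by simp
  consider "e < t l" | "e = t l" | "e > t l" by linarith
  then show ?case
  proof cases
    case 1
    have "digit_val ?U (es @ [d]) < ?U (length (es @ [d]))"
      using gr nz by (intro greedy_imp_val_less) auto
    then have "digit_val ?U es < ?U ?j" using Cons.IH[OF gr, of 0] by simp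
    then have "digit_val ?U (e # es) < Suc e * ?U ?j" by simp
    also have "\<dots> \<le> t l * ?U ?j" using 1 by (intro mult_right_mono) auto
    finally show ?thesis by simp
  next
    case 2
    have "digit_val ?U (es @ [d]) < img_len t (Suc ?j) (Suc l)"
      using bound unfolding 2 by (rule add_less_imp_less_left)
    from Cons.IH[OF gr this] 2 show ?thesis by simp
  next
    case 3
    have "t l * ?U (Suc ?j) + img_len t (Suc ?j) (Suc l) \<le> Suc (t l) * ?U (Suc ?j)"
      using img_len_le_U[OF parry, of "Suc ?j" "Suc l"] by (simp del: img_len.simps)
    also have "\<dots> \<le> e * ?U (Suc ?j)" using 3 by (intro mult_right_mono) auto
    finally show ?thesis using bound by linarith
  qed
qed

lemma greedy_butlast:
  assumes "parry_condition t" "t 0 \<noteq> 0" "greedy (\<lambda>j. img_len t j 0) (ds @ [d])"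
  shows "greedy (\<lambda>j. img_len t j 0) ds"
  using assms(3)
proof (induction ds)
  case (Cons e es)
  then have "digit_val (\<lambda>j. img_len t j 0) (e # es) < img_len t (length (e # es)) 0"
    using assms by (intro digit_val_butlast_less_img_len) auto
  then show ?case using Cons by simp
qed simp

lemma greedy_digit_le:
  assumes "parry_condition t" "t 0 \<noteq> 0" "greedy (\<lambda>j. img_len t j 0) ds" "d \<in> set ds"
  shows "d \<le> t 0"
  using assms(3,4)
proof (induction ds)
  case (Cons e es)
  let ?U = "\<lambda>j. img_len t j 0"
  have "e * ?U (length es) < ?U (Suc (length es))" using Cons.prems(1) by simp
  also have "\<dots> \<le> Suc (t 0) * ?U (length es)"
    using img_len_le_U[OF assms(1), of "length es" "Suc 0"] by simp
  finally have "e < Suc (t 0)" by (meson mult_less_cancel2)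
  then show ?case using Cons by auto
qed simp

lemma normal_rep_eq_greedy_digits:
  assumes "strict_mono U" "U k \<le> n" "n < U (Suc k)"
  shows "normal_rep U n = greedy_digits U (Suc k) n"
proof -
  have "(THE k. U k \<le> n \<and> n < U (Suc k)) = k"
  proof (rule the_equality)
    fix i assume i: "U i \<le> n \<and> n < U (Suc i)"
    then have "U i < U (Suc k)" "U k < U (Suc i)" using assms by linarith+
    then show "i = k" using strict_mono_less[OF assms(1)] by (simp add: less_Suc_eq_le)
  qed (use assms in simp)
  then show ?thesis unfolding normal_rep_def by simp
qed

text \<open>
  One step of the automaton backwards. The shortened string \<open>ds\<close> is greedy again, and its leading
  digit is still nonzero, so \<open>ds\<close> is the full normal representation of its value \<open>q\<close>, with leading
  position exactly one lower.
\<close>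

lemma normal_rep_cases:
  assumes parry: "parry_condition t" and nz: "\<exists>i\<ge>1. t i \<noteq> 0"
    and U: "\<And>j. U j = img_len t j 0"
    and N: "U k \<le> N" "N < U (Suc k)"
  obtains (single) "k = 0" "N \<in> {1..t 0}" "normal_rep U N = [N]"
    | (snoc) i q d where "k = Suc i" "U i \<le> q" "q < U (Suc i)" "d \<in> {0..t 0}"
        "normal_rep U N = normal_rep U q @ [d]"
proof -
  have U_eq: "U = (\<lambda>j. img_len t j 0)" using U by auto
  have t0: "t 0 \<noteq> 0" using parry_condition_head_pos[OF parry nz] by simp
  have U0: "U 0 = 1" using t0 U by auto
  have pos: "U i > 0" for i using t0 unfolding U by (intro img_len_pos) auto
  have mono: "strict_mono U"
    unfolding strict_mono_Suc_iff U using U_less_Suc[OF parry nz] by blast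
  have rep: "normal_rep U N = greedy_digits U (Suc k) N"
    using normal_rep_eq_greedy_digits[OF mono N] .
  show ?thesis
  proof (cases k)
    case 0
    have "N < t 0 * U 0 + 1" using N(2) 0 nz U0 by (simp add: U)
    then show ?thesis using 0 N(1) U0 rep by (intro single) auto
  next
    case (Suc i)
    define ds where "ds = butlast (greedy_digits U (Suc k) N)"
    define d where "d = last (greedy_digits U (Suc k) N)"
    have split: "greedy_digits U (Suc k) N = ds @ [d]"
      unfolding ds_def d_def by simp
    have len: "length ds = Suc i" unfolding ds_def length_butlast length_greedy_digits using Suc by simp
    have greedy: "greedy U (ds @ [d])"
      using greedy_greedy_digits[OF pos N(2) U0] unfolding split by blast
    then have d: "d \<le> t 0" using greedy_digit_le[OF parry t0] unfolding U_eq by simp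
    have greedy': "greedy U ds" using greedy greedy_butlast[OF parry t0] unfolding U_eq by blast
    define q where "q = digit_val U ds"
    have q_less: "q < U (Suc i)"
      using greedy_imp_val_less[OF greedy'] pos len unfolding q_def by metis
    obtain e es where es: "ds = e # es" using len by (cases ds) auto
    have "e = N div U k" using split es by simp
    then have "e \<ge> 1" using N(1) pos[of k] by (simp add: Suc_le_eq div_greater_zero_iff)
    then have "U i \<le> e * U i" by simp
    then have q_ge: "U i \<le> q" unfolding q_def using es len by (simp add: trans_le_add1)
    have "normal_rep U q = ds"
      using normal_rep_eq_greedy_digits[OF mono q_ge q_less]
        greedy_digits_unique[OF greedy'] pos len unfolding q_def by metis
    then show ?thesis using Suc q_ge q_less d rep split by (intro snoc) auto
  qed
qed


section \<open>Iterated images of a substitution\<close>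

lemma subst_word_append [simp]:
  "subst_word \<phi> (v @ w) = subst_word \<phi> v @ subst_word \<phi> w"
  by (simp add: subst_word_def)

lemma subst_word_Nil [simp]: "subst_word \<phi> [] = []"
  by (simp add: subst_word_def)

lemma subst_word_pow_append:
  "(subst_word \<phi> ^^ k) (v @ w) = (subst_word \<phi> ^^ k) v @ (subst_word \<phi> ^^ k) w"
  by (induction k) auto

lemma subst_word_pow_Nil [simp]: "(subst_word \<phi> ^^ k) [] = []"
  by (induction k) auto

lemma length_subst_word_pow_replicate:
  "length ((subst_word \<phi> ^^ k) (replicate r a)) = r * length ((subst_word \<phi> ^^ k) [a])"
proof (induction r)
  case (Suc r)
  have "replicate (Suc r) a = [a] @ replicate r a" by simp
  then show ?case using Suc subst_word_pow_append[of k \<phi> "[a]" "replicate r a"] by simp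
qed simp

lemma length_subst_word_pow_Suc:
  "length ((subst_word \<phi> ^^ Suc k) [l]) = length ((subst_word \<phi> ^^ k) (\<phi> l))"
  by (simp add: funpow_swap1 subst_word_def)

lemma factor_at_add: "factor_at u j (a + b) = factor_at u j a @ factor_at u (j + a) b"
  unfolding factor_at_def
  by (metis add.assoc le_add1 map_append upt_add_eq_append)

lemma length_factor_at [simp]: "length (factor_at u j n) = n"
  by (simp add: factor_at_def)

lemma factor_at_1 [simp]: "factor_at u j (Suc 0) = [u j]"
  by (simp add: factor_at_def)

lemma subst_word_pow_prefix:
  assumes "fixed_point \<phi> u"
  shows "(subst_word \<phi> ^^ k) (factor_at u 0 n)
    = factor_at u 0 (length ((subst_word \<phi> ^^ k) (factor_at u 0 n)))"
proof (induction k)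
  case (Suc k)
  let ?w = "(subst_word \<phi> ^^ k) (factor_at u 0 n)"
  have "subst_word \<phi> ?w = factor_at u 0 (length (subst_word \<phi> ?w))"
    using Suc assms unfolding fixed_point_def by metis
  then show ?case by simp
qed simp

lemma factor_at_image_of_letter:
  assumes "fixed_point \<phi> u"
  shows "factor_at u (length ((subst_word \<phi> ^^ k) (factor_at u 0 p)))
      (length ((subst_word \<phi> ^^ k) [u p])) = (subst_word \<phi> ^^ k) [u p]"
proof -
  let ?g = "subst_word \<phi> ^^ k"
  let ?a = "length (?g (factor_at u 0 p))" and ?b = "length (?g [u p])"
  have "?g (factor_at u 0 (Suc p)) = ?g (factor_at u 0 p) @ ?g [u p]"
    using factor_at_add[of u 0 p 1] subst_word_pow_append by simp
  then have "factor_at u 0 (?a + ?b) = ?g (factor_at u 0 p) @ ?g [u p]"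
    using subst_word_pow_prefix[OF assms, of k "Suc p"] by simp
  then show ?thesis by (simp add: factor_at_add)
qed

lemma letter_in_image_of_letter:
  assumes "fixed_point \<phi> u" "i < length (\<phi> (u p))"
  shows "u (length (subst_word \<phi> (factor_at u 0 p)) + i) = \<phi> (u p) ! i"
  using factor_at_image_of_letter[OF assms(1), of 1 p] assms(2)
  by (simp add: subst_word_def factor_at_def) (metis (no_types, lifting) add_diff_cancel_left'
      length_upt nat_add_left_cancel_less nth_map nth_upt)

text \<open>
  A second occurrence of the first letter suffices for recurrence, since it is followed, after
  applying the substitution many times, by a long prefix of the word arbitrarily far to the right.
\<close>

lemma fixed_point_recurrent:
  assumes fp: "fixed_point \<phi> u" and p: "p > 0" "u p = u 0"
    and unbounded: "\<And>B. \<exists>k. B \<le> length ((subst_word \<phi> ^^ k) [u 0])"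
  shows "\<exists>i\<ge>b. factor_at u i n = factor_at u j n"
proof -
  obtain k where k: "max b (j + n) \<le> length ((subst_word \<phi> ^^ k) [u 0])"
    using unbounded by blast
  let ?g = "subst_word \<phi> ^^ k"
  let ?s = "length (?g (factor_at u 0 p))" and ?r = "length (?g [u 0])"
  have "factor_at u 0 p = [u 0] @ factor_at u 1 (p - 1)"
    using factor_at_add[of u 0 1 "p - 1"] p(1) by simp
  then have "?g (factor_at u 0 p) = ?g [u 0] @ ?g (factor_at u 1 (p - 1))"
    using subst_word_pow_append by metis
  then have s: "?r \<le> ?s" by simp
  obtain e where e: "?r = j + (n + e)" using k by (metis add.assoc le_Suc_ex max.bounded_iff)
  have "factor_at u ?s ?r = factor_at u 0 ?r"
    using factor_at_image_of_letter[OF fp, of k p] factor_at_image_of_letter[OF fp, of k 0] p(2)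
    by (simp add: factor_at_def)
  then have "factor_at u (?s + j) n = factor_at u j n"
    unfolding e by (simp add: factor_at_add)
  then show ?thesis using s k by (intro exI[of _ "?s + j"]) auto
qed


section \<open>Parry words\<close>

text \<open>
  The last item says that the last letter is not mapped to itself, and that its image is nonempty;
  this is what forces \<open>u\<close> to begin with \<open>0\<close>.
\<close>

lemma parry_word_common:
  assumes "parry_word K \<alpha> \<phi> u"
  shows "K \<ge> 2" "\<alpha> 0 \<ge> 1" "fixed_point \<phi> u" "\<And>i. u i < K"
    "\<And>l. l < K - 1 \<Longrightarrow> \<phi> l = replicate (\<alpha> l) 0 @ [l + 1]"
    "\<exists>l\<ge>1. l < K \<and> \<alpha> l \<ge> 1"
    "\<exists>v. \<phi> (K - 1) = replicate (\<alpha> (K - 1)) 0 @ v \<and>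
       (\<alpha> (K - 1) = 0 \<longrightarrow> (\<exists>l<K - 1. v = [l]))"
proof -
  consider (simple) "simple_parry_word K \<alpha> \<phi> u"
    | (nonsimple) m p where "K = m + p" "nonsimple_parry_word m p \<alpha> \<phi> u"
    using assms unfolding parry_word_def by blast
  then have "K \<ge> 2 \<and> \<alpha> 0 \<ge> 1 \<and> fixed_point \<phi> u \<and> (\<forall>i. u i < K) \<and>
    (\<forall>l<K - 1. \<phi> l = replicate (\<alpha> l) 0 @ [l + 1]) \<and> (\<exists>l\<ge>1. l < K \<and> \<alpha> l \<ge> 1) \<and>
    (\<exists>v. \<phi> (K - 1) = replicate (\<alpha> (K - 1)) 0 @ v \<and>
       (\<alpha> (K - 1) = 0 \<longrightarrow> (\<exists>l<K - 1. v = [l])))"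
  proof cases
    case simple
    then show ?thesis unfolding simple_parry_word_def
      by (intro conjI exI[of _ "K - 1"] exI[of _ "[]"]) auto
  next
    case nonsimple
    then have ns: "m \<ge> 1" "p \<ge> 1" "\<exists>l\<in>{m..<m + p}. \<alpha> l \<ge> 1"
      unfolding nonsimple_parry_word_def by auto
    \<comment> \<open>If \<open>p = 1\<close>, the last letter is the whole period, so its \<open>\<alpha>\<close> is positive.\<close>
    have "\<alpha> (m + p - 1) = 0 \<Longrightarrow> m < m + p - 1"
    proof (rule ccontr)
      assume z: "\<alpha> (m + p - 1) = 0" "\<not> m < m + p - 1"
      then have "p = 1" using ns(2) by linarith
      then show False using z ns(3) by auto
    qed
    moreover have "\<exists>l\<ge>1. l < m + p \<and> \<alpha> l \<ge> 1" using ns by (metis atLeastLessThan_iff le_trans)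
    ultimately show ?thesis using nonsimple unfolding nonsimple_parry_word_def by auto
  qed
  then show "K \<ge> 2" "\<alpha> 0 \<ge> 1" "fixed_point \<phi> u" "\<And>i. u i < K"
    "\<And>l. l < K - 1 \<Longrightarrow> \<phi> l = replicate (\<alpha> l) 0 @ [l + 1]"
    "\<exists>l\<ge>1. l < K \<and> \<alpha> l \<ge> 1"
    "\<exists>v. \<phi> (K - 1) = replicate (\<alpha> (K - 1)) 0 @ v \<and>
       (\<alpha> (K - 1) = 0 \<longrightarrow> (\<exists>l<K - 1. v = [l]))"
    by blast+
qed

lemma img_len_eq_0:
  assumes "\<And>i. i \<ge> l \<Longrightarrow> t i = 0"
  shows "img_len t j l = 0"
  using assms by (induction j arbitrary: l) auto

lemma img_len_periodic:
  assumes "\<And>i. i \<ge> l \<Longrightarrow> t (i + p) = t i"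
  shows "img_len t j (l + p) = img_len t j l"
  using assms
proof (induction j arbitrary: l)
  case 0
  have "(\<exists>i\<ge>l + p. t i \<noteq> 0) \<longleftrightarrow> (\<exists>i\<ge>l. t i \<noteq> 0)"
    using 0 by (metis add_le_cancel_right le_Suc_ex trans_le_add1 add.assoc add.commute le_add1)
  then show ?case by simp
next
  case (Suc j)
  have "img_len t j (Suc l + p) = img_len t j (Suc l)" using Suc.prems by (intro Suc.IH) auto
  then show ?case using Suc.prems[of l] by simp
qed

lemma simple_parry_word_length:
  assumes "simple_parry_word m \<alpha> \<phi> u" "l < m"
  defines "t \<equiv> (\<lambda>i. if i < m then \<alpha> i else 0)"
  shows "length ((subst_word \<phi> ^^ j) [l]) = img_len t j l"
  using assms(2)
proof (induction j arbitrary: l)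
  case 0
  have "t (m - 1) \<noteq> 0" using assms(1) unfolding simple_parry_word_def t_def by auto
  then show ?case using 0 by (auto intro!: exI[of _ "m - 1"])
next
  case (Suc j)
  have m: "m \<ge> 2" and \<phi>: "\<And>l. l < m - 1 \<Longrightarrow> \<phi> l = replicate (\<alpha> l) 0 @ [l + 1]"
    "\<phi> (m - 1) = replicate (\<alpha> (m - 1)) 0"
    using assms(1) unfolding simple_parry_word_def by auto
  have U: "length ((subst_word \<phi> ^^ j) [0]) = img_len t j 0" using m by (intro Suc.IH) auto
  show ?case
  proof (cases "l = m - 1")
    case True
    have "img_len t j (Suc l) = 0" using True m by (intro img_len_eq_0) (auto simp: t_def)
    then show ?thesis unfolding length_subst_word_pow_Suc
      using True \<phi>(2) m by (simp add: length_subst_word_pow_replicate U t_def)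
  next
    case False
    then have l: "l < m - 1" using Suc.prems by linarith
    then have "length ((subst_word \<phi> ^^ j) [Suc l]) = img_len t j (Suc l)" by (intro Suc.IH) auto
    then show ?thesis unfolding length_subst_word_pow_Suc
      using \<phi>(1)[OF l] Suc.prems
      by (simp add: subst_word_pow_append length_subst_word_pow_replicate U t_def)
  qed
qed

lemma nonsimple_parry_word_length:
  assumes "nonsimple_parry_word m p \<alpha> \<phi> u" "l < m + p"
  defines "t \<equiv> (\<lambda>i. if i < m then \<alpha> i else \<alpha> (m + (i - m) mod p))"
  shows "length ((subst_word \<phi> ^^ j) [l]) = img_len t j l"
proof -
  have mp: "m \<ge> 1" "p \<ge> 1" and \<phi>: "\<And>l. l < m + p - 1 \<Longrightarrow> \<phi> l = replicate (\<alpha> l) 0 @ [l + 1]"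
    "\<phi> (m + p - 1) = replicate (\<alpha> (m + p - 1)) 0 @ [m]"
    using assms(1) unfolding nonsimple_parry_word_def by auto
  have t_eq: "t i = \<alpha> i" if "i < m + p" for i
    using that by (auto simp: t_def)
  have period: "t (i + p) = t i" if "i \<ge> m" for i
  proof -
    have "i + p - m = (i - m) + p" using that by simp
    then have "(i + p - m) mod p = (i - m) mod p" by simp
    then show ?thesis using that by (simp add: t_def)
  qed
  have nz: "\<exists>i\<ge>l. t i \<noteq> 0" for l
  proof -
    obtain r where r: "r \<in> {m..<m + p}" "\<alpha> r \<ge> 1"
      using assms(1) unfolding nonsimple_parry_word_def by blast
    have "t (r + k * p) = t r" for k
    proof (induction k)
      case (Suc k)
      then show ?case using period[of "r + k * p"] r(1) by (simp add: add_ac)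
    qed simp
    then have "t (r + l * p) \<noteq> 0" using r t_eq[of r] by simp
    moreover have "l \<le> r + l * p" using mp by (simp add: trans_le_add2)
    ultimately show ?thesis by blast
  qed
  show ?thesis
    using assms(2)
  proof (induction j arbitrary: l)
    case 0
    then show ?case using nz by simp
  next
    case (Suc j)
    have U: "length ((subst_word \<phi> ^^ j) [0]) = img_len t j 0" using mp by (intro Suc.IH) auto
    show ?case
    proof (cases "l = m + p - 1")
      case True
      have "img_len t j (Suc l) = img_len t j (m + p)" using True mp by simp
      also have "\<dots> = img_len t j m" using period by (rule img_len_periodic)
      also have "\<dots> = length ((subst_word \<phi> ^^ j) [m])" using mp by (intro Suc.IH[symmetric]) auto
      finally show ?thesis unfolding length_subst_word_pow_Suc
        using True \<phi>(2) t_eq[OF Suc.prems]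
        by (simp add: subst_word_pow_append length_subst_word_pow_replicate U)
    next
      case False
      then have l: "l < m + p - 1" using Suc.prems by linarith
      then have "length ((subst_word \<phi> ^^ j) [Suc l]) = img_len t j (Suc l)" by (intro Suc.IH) auto
      then show ?thesis unfolding length_subst_word_pow_Suc
        using \<phi>(1)[OF l] t_eq[OF Suc.prems]
        by (simp add: subst_word_pow_append length_subst_word_pow_replicate U)
    qed
  qed
qed

lemma parry_word_numeration:
  assumes "parry_word K \<alpha> \<phi> u"
  obtains t where "parry_condition t" "t 0 = \<alpha> 0" "\<exists>i\<ge>1. t i \<noteq> 0"
    "\<And>j. U_seq \<phi> j = img_len t j 0"
proof -
  consider (simple) "simple_parry_word K \<alpha> \<phi> u"
    | (nonsimple) m p where "K = m + p" "nonsimple_parry_word m p \<alpha> \<phi> u"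
    using assms unfolding parry_word_def by blast
  then show ?thesis
  proof cases
    case simple
    let ?t = "\<lambda>i. if i < K then \<alpha> i else 0"
    show ?thesis
    proof (rule that)
      show "parry_condition ?t" "?t 0 = \<alpha> 0" using simple unfolding simple_parry_word_def by auto
      show "\<exists>i\<ge>1. ?t i \<noteq> 0"
        using simple unfolding simple_parry_word_def by (intro exI[of _ "K - 1"]) auto
      show "U_seq \<phi> j = img_len ?t j 0" for j
        unfolding U_seq_def using simple
        by (intro simple_parry_word_length[OF simple]) (auto simp: simple_parry_word_def)
    qed
  next
    case nonsimple
    let ?t = "\<lambda>i. if i < m then \<alpha> i else \<alpha> (m + (i - m) mod p)"
    have mp: "m \<ge> 1" "p \<ge> 1" and ex: "\<exists>l\<in>{m..<m + p}. \<alpha> l \<ge> 1"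
      using nonsimple unfolding nonsimple_parry_word_def by auto
    show ?thesis
    proof (rule that)
      show "parry_condition ?t" "?t 0 = \<alpha> 0"
        using nonsimple unfolding nonsimple_parry_word_def by auto
      obtain l where l: "l \<in> {m..<m + p}" "\<alpha> l \<ge> 1" using ex by blast
      then have "?t l \<noteq> 0" by auto
      moreover have "l \<ge> 1" using l mp by auto
      ultimately show "\<exists>i\<ge>1. ?t i \<noteq> 0" by blast
      show "U_seq \<phi> j = img_len ?t j 0" for j
        unfolding U_seq_def using mp by (intro nonsimple_parry_word_length[OF nonsimple(2)]) auto
    qed
  qed
qed

lemma parry_word_first_letter:
  assumes "parry_word K \<alpha> \<phi> u"
  shows "u 0 = 0"
proof (rule ccontr)
  note common = parry_word_common[OF assms]
  assume "u 0 \<noteq> 0"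
  have first: "\<phi> (u 0) \<noteq> [] \<Longrightarrow> u 0 = \<phi> (u 0) ! 0"
    using letter_in_image_of_letter[OF common(3), of 0 0] by (simp add: factor_at_def)
  obtain v where v: "\<phi> (K - 1) = replicate (\<alpha> (K - 1)) 0 @ v"
    "\<alpha> (K - 1) = 0 \<longrightarrow> (\<exists>l<K - 1. v = [l])" by (metis common(7))
  obtain w where w: "\<phi> (u 0) = replicate (\<alpha> (u 0)) 0 @ w"
    "\<alpha> (u 0) = 0 \<Longrightarrow> \<exists>l. l \<noteq> u 0 \<and> w = [l]"
  proof (cases "u 0 = K - 1")
    case True
    then show ?thesis using v that[of v] by fastforce
  next
    case False
    then have "u 0 < K - 1" using common(4)[of 0] by linarith
    then show ?thesis using common(5) that[of "[u 0 + 1]"] by simp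
  qed
  show False
  proof (cases "\<alpha> (u 0) = 0")
    case True
    then show False using w first by auto
  next
    case False
    then show False using w(1) first \<open>u 0 \<noteq> 0\<close> by (simp add: nth_append)
  qed
qed

text \<open>
  Each letter \<open>l + 1\<close> ends the image of \<open>l\<close>, so that every letter \<open>\<ge> 1\<close> occurs, necessarily after
  the initial \<open>0\<close>. One of them has an image that begins with \<open>0\<close>, which yields the second
  occurrence of \<open>0\<close>.
\<close>

lemma parry_word_recurrent:
  assumes "parry_word K \<alpha> \<phi> u"
  shows "\<exists>i\<ge>b. factor_at u i n = factor_at u j n"
proof -
  note common = parry_word_common[OF assms]
  note fp = common(3)
  have u0: "u 0 = 0" using parry_word_first_letter[OF assms] .
  have \<phi>0: "\<phi> 0 = replicate (\<alpha> 0) 0 @ [1]" using common(1) common(5)[of 0] by simp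
  have image_pos: "length (subst_word \<phi> (factor_at u 0 p)) > 0" if "p > 0" for p
    using factor_at_add[of u 0 1 "p - 1"] that u0 \<phi>0 by (simp add: subst_word_def)
  have occurs: "\<exists>p>0. u p = Suc l" if "Suc l < K" for l
    using that
  proof (induction l)
    case 0
    then show ?case using letter_in_image_of_letter[OF fp, of "\<alpha> 0" 0] u0 \<phi>0 common(2)
      by (intro exI[of _ "\<alpha> 0"]) (simp add: factor_at_def nth_append)
  next
    case (Suc l)
    then obtain p where p: "p > 0" "u p = Suc l" by auto
    have "\<phi> (u p) = replicate (\<alpha> (u p)) 0 @ [Suc (Suc l)]"
      using common(5)[of "Suc l"] Suc.prems p by simp
    then show ?case using letter_in_image_of_letter[OF fp, of "\<alpha> (u p)" p] image_pos[OF p(1)]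
      by (intro exI[of _ "length (subst_word \<phi> (factor_at u 0 p)) + \<alpha> (u p)"])
        (simp add: nth_append)
  qed
  obtain l where l: "l \<ge> 1" "l < K" "\<alpha> l \<ge> 1" using common(6) by blast
  then obtain p where p: "p > 0" "u p = l" using occurs[of "l - 1"] by auto
  have "\<exists>v. \<phi> l = replicate (\<alpha> l) 0 @ v"
    using common(5)[of l] common(7) l by (cases "l = K - 1") auto
  then have "\<phi> (u p) ! 0 = 0" "\<phi> (u p) \<noteq> []" using l p by (auto simp: nth_append)
  then have "u (length (subst_word \<phi> (factor_at u 0 p))) = u 0"
    using letter_in_image_of_letter[OF fp, of 0 p] u0 by simp
  moreover obtain t where t: "parry_condition t" "\<exists>i\<ge>1. t i \<noteq> 0" "\<And>j. U_seq \<phi> j = img_len t j 0"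
    using parry_word_numeration[OF assms] by metis
  have "strict_mono (U_seq \<phi>)"
    unfolding strict_mono_Suc_iff t(3) using U_less_Suc[OF t(1,2)] by blast
  then have "B \<le> U_seq \<phi> B" for B using strict_mono_imp_increasing by blast
  then have "\<exists>k. B \<le> length ((subst_word \<phi> ^^ k) [u 0])" for B
    unfolding U_seq_def u0 by blast
  ultimately show ?thesis using fixed_point_recurrent[OF fp image_pos[OF p(1)]] by blast
qed


section \<open>The automaton computes the abelian complexity\<close>

lemma abelian_complexity_eq_card_P_rel:
  assumes "parry_word K \<alpha> \<phi> u" "n \<ge> 1"
  shows "abelian_complexity u n = card (P_rel (S_set u L n))"
proof -
  let ?A = "{parikh w | w. w \<in> factors u \<and> length w = n}"
  let ?shift = "\<lambda>x l. x l - parikh (factor_at u 0 n) l"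
  have "?A = (\<lambda>j. parikh (factor_at u j n)) ` {j. j \<ge> L}"
  proof (intro set_eqI iffI)
    fix x assume "x \<in> ?A"
    then obtain j where "x = parikh (factor_at u j n)" unfolding factors_def by auto
    then show "x \<in> (\<lambda>j. parikh (factor_at u j n)) ` {j. j \<ge> L}"
      using parry_word_recurrent[OF assms(1), of L n j] by (auto simp: image_iff)
  qed (use factors_def length_factor_at in blast)
  moreover have "P_rel (S_set u L n) = (\<lambda>j. parikh_rel u (factor_at u j n)) ` {j. j \<ge> L}"
    using assms(2) unfolding P_rel_def S_set_def by auto
  ultimately have "P_rel (S_set u L n) = ?shift ` ?A"
    unfolding parikh_rel_def by (simp add: image_image)
  moreover have "inj_on ?shift ?A"
    by (intro inj_onI) (simp add: fun_eq_iff)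
  ultimately show ?thesis unfolding abelian_complexity_def by (simp add: card_image)
qed

theorem theorem3p13:
  fixes K L M :: nat
    and \<alpha> :: "nat \<Rightarrow> nat"
    and \<phi> :: "nat \<Rightarrow> nat list"
    and u :: "nat \<Rightarrow> nat"
    and c H :: real
    and S :: "nat \<Rightarrow> triple set"
    and \<delta> :: "nat \<Rightarrow> nat \<Rightarrow> nat"
    and n :: nat
  assumes parry: "parry_word K \<alpha> \<phi> u"
    and c_pos: "c > 0"
    and balanced: "balanced K u c"
    and H: "\<forall>w\<in>factors u. real_of_int \<bar>h_sum K \<phi> u w\<bar> \<le> H"
    and L_pos: "L \<ge> 1"
    and L: "\<forall>w\<in>factors u. length w \<ge> L \<longrightarrow>
              real (length (subst_word \<phi> w)) - real (length w) \<ge> 2 * real (\<alpha> 0) + H"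
    and S_0: "S 0 = {}"
    and S_finite: "\<forall>j\<in>{1..M}. finite (S j)"
    and S_complete: "\<forall>k\<ge>1. \<exists>j\<in>{1..M}. S_set u L k = S j"
    and S_digits: "\<alpha> 0 \<le> M" "\<forall>d\<in>{1..\<alpha> 0}. S d = S_set u L d"
    and \<delta>_range: "\<forall>j\<in>{1..M}. \<forall>d\<in>{0..\<alpha> 0}. \<delta> j d \<in> {1..M}"
    and \<delta>_step: "\<forall>k\<ge>1. \<forall>N\<ge>1. \<forall>d\<in>{0..\<alpha> 0}.
                   normal_rep (U_seq \<phi>) N = normal_rep (U_seq \<phi>) k @ [d] \<longrightarrow>
                   (\<forall>j\<in>{1..M}. S_set u L k = S j \<longrightarrow> S_set u L N = S (\<delta> j d))"
    and \<delta>_0: "\<forall>d\<in>{1..\<alpha> 0}. \<delta> 0 d = d"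
    and n_pos: "n \<ge> 1"
  shows "abelian_complexity u n = tau S (delta_word \<delta> 0 (normal_rep (U_seq \<phi>) n))"
proof -
  obtain t where t: "parry_condition t" "t 0 = \<alpha> 0" "\<exists>i\<ge>1. t i \<noteq> 0"
    and U: "\<And>j. U_seq \<phi> j = img_len t j 0"
    using parry_word_numeration[OF parry] by metis
  let ?U = "U_seq \<phi>"
  have U0: "?U 0 = 1" by (simp add: U_seq_def)
  have mono: "strict_mono ?U"
    unfolding strict_mono_Suc_iff U using U_less_Suc[OF t(1,3)] by blast
  have state: "delta_word \<delta> 0 (normal_rep ?U N) \<in> {1..M} \<and>
      S_set u L N = S (delta_word \<delta> 0 (normal_rep ?U N))"
    if "?U k \<le> N" "N < ?U (Suc k)" for k N
    using that
  proof (induction k arbitrary: N)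
    case 0
    show ?case
    proof (cases rule: normal_rep_cases[OF t(1,3) U 0])
      case 1
      then show ?thesis using t(2) \<delta>_0 S_digits by (simp add: delta_word_def)
    qed simp
  next
    case (Suc k)
    show ?case
    proof (cases rule: normal_rep_cases[OF t(1,3) U Suc.prems])
      case (2 i q d)
      let ?j = "delta_word \<delta> 0 (normal_rep ?U q)"
      have IH: "?j \<in> {1..M}" "S_set u L q = S ?j" using Suc.IH[of q] 2 by auto
      have "1 \<le> ?U i" for i using strict_mono_less_eq[OF mono, of 0 i] U0 by simp
      then have "q \<ge> 1" "N \<ge> 1" using 2(2) Suc.prems(1) le_trans by blast+
      moreover have d: "d \<in> {0..\<alpha> 0}" using 2(4) t(2) by simp
      ultimately have "S_set u L N = S (\<delta> ?j d)" using \<delta>_step 2(5) IH by blast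
      moreover have "\<delta> ?j d \<in> {1..M}" using \<delta>_range IH(1) d by blast
      ultimately show ?thesis using 2(5) by (simp add: delta_word_def)
    qed simp
  qed
  \<comment> \<open>The position of the leading digit of \<open>n\<close>.\<close>
  obtain k where "?U k \<le> n" "n < ?U (Suc k)"
  proof -
    have "n < ?U (Suc n)" using strict_mono_imp_increasing[OF mono, of "Suc n"] by simp
    then obtain r where r: "n < ?U r" "\<forall>i<r. \<not> n < ?U i"
      using exists_least_iff[of "\<lambda>r. n < ?U r"] by blast
    then obtain k where "r = Suc k" using n_pos U0 by (cases r) auto
    then show ?thesis using r that[of k] by (simp add: not_less)
  qed
  then have "S_set u L n = S (delta_word \<delta> 0 (normal_rep ?U n))" using state by blast
  then show ?thesis
    unfolding tau_def using abelian_complexity_eq_card_P_rel[OF parry n_pos, of L] by simp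
qed

end
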